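(* Let $\tau=e^{2\pi\mathbf i/3}$ and let $\mathbb T$ be the directed triangular lattice. For each $v\in\mathbb T$ let $(\alpha_0(v),\alpha_1(v),\alpha_2(v))\in\mathbb R^3$ be given, put $a(v)=\sum_{k=0}^2e^{\alpha_k(v)}$, and let $\mathbb Q_x$ be the law of the Markov chain on $\mathbb T$ started at $x$ with transition probabilities $$\mathbb Q(v,v+\tau^k)=\frac{e^{\alpha_k(v)}}{a(v)},\qquad k=0,1,2.$$ Let $\mathbb P_x$ be the law of simple random walk on $\mathbb T$ started at $x$ (each of the steps $1,\tau,\tau^2$ has probability $1/3$). Let $\alpha(v)=\frac23(\alpha_0(v)+\alpha_1(v)\tau+\alpha_2(v)\tau^2)\in\mathbb C\simeq\mathbb R^2$ and define $\beta(v)\ge0$ by $$\exp(-\beta(v)^2)=\Big(\frac{a(v)}3\Big)^{-3}\prod_{k=0}^2e^{\alpha_k(v)}.$$ Then for every finite path $\gamma=(x_0,\dots,x_n)$ in $\mathbb T$ with $x_0=x$ and $dx_s:=x_{s+1}-x_s\in\{1,\tau,\tau^2\}$ for $0\le s\le n-1$, $$\frac{\mathbb Q_x(\gamma)}{\mathbb P_x(\gamma)}=\exp\big(M_n-\tfrac12V_n\big),\qquad M_n=\sum_{s=0}^{n-1}\langle\alpha(x_s),dx_s\rangle,\qquad V_n=\frac23\sum_{s=0}^{n-1}\beta^2(x_s).$$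
   Context: The directed triangular lattice $\mathbb T$ has vertex set $\{a+b\tau:a,b\in\mathbb Z\}$ and directed edges $v\to v+\tau^k$, $k=0,1,2$. $\langle\cdot,\cdot\rangle$ is the Euclidean inner product on $\mathbb C\simeq\mathbb R^2$. For a law $\mathbb P_x$ of a chain $X$, $\mathbb P_x(\gamma)$ denotes the probability that $X_s=x_s$ for all $0\le s\le n$. The quantity $\beta(v)$ is well defined by the arithmetic-geometric mean inequality. *)

theory Defs
  imports "HOL-Probability.Probability"
begin

definition tau :: complex where
  "tau = exp (2 * complex_of_real pi * \<i> / 3)"

text \<open>The vertex set of the directed triangular lattice.  Its edges \<open>v \<rightarrow> v + tau ^ k\<close>, \<open>k < 3\<close>,
  are the only pairs to which \<open>lattice_kernel\<close> below assigns positive mass.\<close>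

definition tri_lattice :: "complex set" where
  "tri_lattice = {of_int a + of_int b * tau | a b. True}"

text \<open>\<open>L\<close> is the law, as a measure on the path space over \<open>S\<close>, of the Markov chain with state space
  \<open>S\<close>, transition probabilities \<open>K v w\<close> and starting point \<open>x\<close>.\<close>

definition markov_law :: "'s set \<Rightarrow> ('s \<Rightarrow> 's \<Rightarrow> real) \<Rightarrow> 's \<Rightarrow> (nat \<Rightarrow> 's) measure \<Rightarrow> bool" where
  "markov_law S K x L \<longleftrightarrow>
     prob_space L \<and>
     sets L = sets (PiM UNIV (\<lambda>_. count_space S)) \<and>
     \<P>(\<omega> in L. \<omega> 0 = x) = 1 \<and>
     (\<forall>n w. \<forall>y\<in>S. \<P>(\<omega> in L. \<forall>s\<le>n. \<omega> s = w s) > 0 \<longrightarrow>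
        \<P>(\<omega> in L. \<omega> (Suc n) = y \<bar> \<forall>s\<le>n. \<omega> s = w s) = K (w n) y)"

text \<open>The transition matrix with entry \<open>p v k\<close> at \<open>(v, v + tau ^ k)\<close> and zero elsewhere.  The three
  steps are distinct, so the sum has at most one term.\<close>

definition lattice_kernel :: "(complex \<Rightarrow> nat \<Rightarrow> real) \<Rightarrow> complex \<Rightarrow> complex \<Rightarrow> real" where
  "lattice_kernel p v w = (\<Sum>k | k < 3 \<and> w = v + tau ^ k. p v k)"

definition total_weight :: "(complex \<Rightarrow> nat \<Rightarrow> real) \<Rightarrow> complex \<Rightarrow> real" where
  "total_weight \<alpha> v = (\<Sum>k<3. exp (\<alpha> v k))"

definition tilted_kernel :: "(complex \<Rightarrow> nat \<Rightarrow> real) \<Rightarrow> complex \<Rightarrow> complex \<Rightarrow> real" where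
  "tilted_kernel \<alpha> = lattice_kernel (\<lambda>v k. exp (\<alpha> v k) / total_weight \<alpha> v)"

definition srw_kernel :: "complex \<Rightarrow> complex \<Rightarrow> real" where
  "srw_kernel = lattice_kernel (\<lambda>v k. 1 / 3)"

definition drift :: "(complex \<Rightarrow> nat \<Rightarrow> real) \<Rightarrow> complex \<Rightarrow> complex" where
  "drift \<alpha> v = 2 / 3 * (\<Sum>k<3. complex_of_real (\<alpha> v k) * tau ^ k)"

text \<open>Existence of this number is the inequality of arithmetic and geometric means for the
  \<open>exp (\<alpha> v k)\<close>.\<close>

definition beta :: "(complex \<Rightarrow> nat \<Rightarrow> real) \<Rightarrow> complex \<Rightarrow> real" where
  "beta \<alpha> v = (THE b. b \<ge> 0 \<and>
     exp (- (b ^ 2)) = (total_weight \<alpha> v / 3) powi (-3) * (\<Prod>k<3. exp (\<alpha> v k)))"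

definition M_term :: "(complex \<Rightarrow> nat \<Rightarrow> real) \<Rightarrow> (nat \<Rightarrow> complex) \<Rightarrow> nat \<Rightarrow> real" where
  "M_term \<alpha> \<gamma> n = (\<Sum>s<n. drift \<alpha> (\<gamma> s) \<bullet> (\<gamma> (s + 1) - \<gamma> s))"

definition V_term :: "(complex \<Rightarrow> nat \<Rightarrow> real) \<Rightarrow> (nat \<Rightarrow> complex) \<Rightarrow> nat \<Rightarrow> real" where
  "V_term \<alpha> \<gamma> n = 2 / 3 * (\<Sum>s<n. (beta \<alpha> (\<gamma> s)) ^ 2)"

text \<open>The laws described by \<open>markov_law\<close> exist, in particular for the two kernels above.\<close>

lemma markov_law_exists:
  fixes S :: "'s set" and K :: "'s \<Rightarrow> 's \<Rightarrow> real"
  assumes S: "countable S" and x: "x \<in> S"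
    and K: "\<And>v. v \<in> S \<Longrightarrow> \<exists>p. set_pmf p \<subseteq> S \<and> (\<forall>w\<in>S. pmf p w = K v w)"
  shows "\<exists>L. markov_law S K x L"
proof -
  have "\<forall>v. \<exists>p. set_pmf p \<subseteq> S \<and> (v \<in> S \<longrightarrow> (\<forall>w\<in>S. pmf p w = K v w))"
  proof
    fix v show "\<exists>p. set_pmf p \<subseteq> S \<and> (v \<in> S \<longrightarrow> (\<forall>w\<in>S. pmf p w = K v w))"
      using K[of v] x by (cases "v \<in> S") (auto intro: exI[of _ "return_pmf x"])
  qed
  then obtain p where p: "\<And>v. set_pmf (p v) \<subseteq> S" "\<And>v w. v \<in> S \<Longrightarrow> w \<in> S \<Longrightarrow> pmf (p v) w = K v w"
    by metis
  define N where "N = (\<lambda>j::nat \<times> 's. restrict_space (measure_pmf (p (snd j))) S)"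
  have spN: "space (N j) = S" for j by (simp add: N_def space_restrict_space)
  have seN: "sets (N j) = Pow S" for j
    by (auto simp: N_def sets_restrict_space)
  have prN: "prob_space (N j)" for j
    unfolding N_def using p(1)[of "snd j"]
    by (intro prob_space_restrict_space measure_pmf.emeasure_eq_1_AE)
       (auto simp: AE_measure_pmf_iff)
  interpret prob_space "N j" for j by (rule prN)
  interpret PN: product_prob_space N UNIV ..
  define M where "M = PiM UNIV N"
  interpret M: prob_space M unfolding M_def by (rule prob_space_PiM) (rule prN)
  have spM: "space M = {\<omega>. \<forall>j. \<omega> j \<in> S}" by (auto simp: M_def space_PiM spN)
  define X where "X = (\<lambda>\<omega>. rec_nat x (\<lambda>n v. \<omega> (n, v)))"
  have X0: "X \<omega> 0 = x" and XS: "X \<omega> (Suc n) = \<omega> (n, X \<omega> n)" for \<omega> n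
    by (simp_all add: X_def)
  have XinS: "\<omega> \<in> space M \<Longrightarrow> X \<omega> n \<in> S" for \<omega> n
    by (cases n) (auto simp: X0 XS x spM)
  have comp: "(\<lambda>\<omega>. \<omega> j) \<in> M \<rightarrow>\<^sub>M count_space S" for j
  proof -
    have *: "sets (count_space S) = sets (N j)" by (simp add: seN)
    show ?thesis
      unfolding M_def measurable_cong_sets[OF refl *]
      by (rule measurable_component_singleton) simp
  qed
  have Xm: "(\<lambda>\<omega>. X \<omega> n) \<in> M \<rightarrow>\<^sub>M count_space S" for n
  proof (induction n)
    case 0 show ?case by (simp add: X0 x)
  next
    case (Suc n)
    show ?case unfolding XS
      by (rule measurable_compose_countable'[OF _ Suc S, of "\<lambda>v \<omega>. \<omega> (n, v)"]) (rule comp)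
  qed
  have cyl: "M.prob {\<omega> \<in> space M. \<forall>s\<le>n. X \<omega> s = w s} = (\<Prod>s<n. K (w s) (w (Suc s)))"
    if w: "w 0 = x" "\<And>s. s \<le> n \<Longrightarrow> w s \<in> S" for n w
  proof -
    define J where "J = (\<lambda>s. (s, w s)) ` {..<n}"
    have iff: "(\<forall>s\<le>m. X \<omega> s = w s) \<longleftrightarrow> (\<forall>s<m. \<omega> (s, w s) = w (Suc s))" for m \<omega>
    proof (induction m)
      case 0 show ?case by (simp add: X0 w)
    next
      case (Suc m)
      have "(\<forall>s\<le>Suc m. X \<omega> s = w s) \<longleftrightarrow> (\<forall>s\<le>m. X \<omega> s = w s) \<and> X \<omega> (Suc m) = w (Suc m)"
        by (auto simp: le_Suc_eq)
      also have "\<dots> \<longleftrightarrow> (\<forall>s\<le>m. X \<omega> s = w s) \<and> \<omega> (m, w m) = w (Suc m)"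
        by (auto simp: XS)
      finally show ?case unfolding Suc by (auto simp: less_Suc_eq)
    qed
    have "{\<omega> \<in> space M. \<forall>s\<le>n. X \<omega> s = w s} = PN.emb UNIV J (PiE J (\<lambda>(s, v). {w (Suc s)}))"
      unfolding iff by (auto simp: prod_emb_def M_def J_def restrict_PiE_iff space_PiM PiE_iff Pi_iff image_iff)
    also have "M.prob \<dots> = (\<Prod>j\<in>J. measure (N j) ((\<lambda>(s, v). {w (Suc s)}) j))"
      unfolding M_def by (rule PN.measure_PiM_emb) (use w in \<open>auto simp: J_def seN\<close>)
    also have "\<dots> = (\<Prod>s<n. measure (N (s, w s)) {w (Suc s)})"
      unfolding J_def by (subst prod.reindex) (auto simp: inj_on_def)
    also have "\<dots> = (\<Prod>s<n. K (w s) (w (Suc s)))"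
      by (intro prod.cong) (use w p(2) in \<open>auto simp: N_def measure_restrict_space measure_pmf_single\<close>)
    finally show ?thesis .
  qed
  define L where "L = distr M (PiM UNIV (\<lambda>_. count_space S)) X"
  have XM: "X \<in> M \<rightarrow>\<^sub>M PiM UNIV (\<lambda>_. count_space S)"
    by (rule measurable_PiM_single') (use Xm XinS in \<open>auto simp: space_PiM\<close>)
  have set1: "{\<omega> \<in> space (PiM UNIV (\<lambda>_. count_space S)). \<omega> s = y} \<in> sets (PiM UNIV (\<lambda>_. count_space S))"
    for s and y :: 's
  proof -
    have "{\<omega> \<in> space (PiM UNIV (\<lambda>_. count_space S)). \<omega> s = y} =
        (\<lambda>\<omega>. \<omega> s) -` ({y} \<inter> S) \<inter> space (PiM UNIV (\<lambda>_. count_space S))"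
      by (auto simp: space_PiM)
    then show ?thesis
      using measurable_sets[OF measurable_component_singleton[of s UNIV "\<lambda>_. count_space S"], of "{y} \<inter> S"]
      by simp
  qed
  have L: "\<P>(\<omega> in L. \<forall>s\<le>n. \<omega> s = w s) = M.prob {\<omega> \<in> space M. \<forall>s\<le>n. X \<omega> s = w s}" for n w
  proof -
    have "{\<omega> \<in> space (PiM UNIV (\<lambda>_. count_space S)). \<forall>s\<le>n. \<omega> s = w s} \<in> sets (PiM UNIV (\<lambda>_. count_space S))"
      using sets.sets_Collect_finite_All[of "{..n}" "PiM UNIV (\<lambda>_. count_space S)" "\<lambda>s \<omega>. \<omega> s = w s"] set1
      by auto
    then show ?thesis
      unfolding L_def using measurable_space[OF XM] by (auto simp: measure_distr[OF XM] intro!: arg_cong[where f = M.prob])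
  qed
  have "markov_law S K x L"
    unfolding markov_law_def
  proof (intro conjI allI ballI impI)
    show "prob_space L" unfolding L_def by (rule M.prob_space_distr[OF XM])
    show "sets L = sets (PiM UNIV (\<lambda>_. count_space S))" by (simp add: L_def)
    show "\<P>(\<omega> in L. \<omega> 0 = x) = 1"
      using L[of 0 "\<lambda>_. x"] cyl[of "\<lambda>_. x" 0] x by simp
    fix n w y assume y: "y \<in> S" and pos: "\<P>(\<omega> in L. \<forall>s\<le>n. \<omega> s = w s) > 0"
    then have "{\<omega> \<in> space M. \<forall>s\<le>n. X \<omega> s = w s} \<noteq> {}" unfolding L by (metis measure_empty less_irrefl)
    then obtain \<omega> where \<omega>: "\<omega> \<in> space M" "\<And>s. s \<le> n \<Longrightarrow> X \<omega> s = w s" by auto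
    have w: "w 0 = x" "\<And>s. s \<le> n \<Longrightarrow> w s \<in> S"
      using \<omega>(2)[of 0] X0 XinS[OF \<omega>(1)] \<omega>(2) by auto metis
    define w' where "w' = w(Suc n := y)"
    have ev: "(\<omega> (Suc n) = y \<and> (\<forall>s\<le>n. \<omega> s = w s)) \<longleftrightarrow> (\<forall>s\<le>Suc n. \<omega> s = w' s)" for \<omega>
      by (auto simp: w'_def le_Suc_eq)
    have "\<P>(\<omega> in L. \<omega> (Suc n) = y \<and> (\<forall>s\<le>n. \<omega> s = w s)) = (\<Prod>s<Suc n. K (w' s) (w' (Suc s)))"
      unfolding ev L by (rule cyl) (use w y in \<open>auto simp: w'_def\<close>)
    also have "\<dots> = (\<Prod>s<n. K (w s) (w (Suc s))) * K (w n) y"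
      by (auto simp: w'_def)
    also have "(\<Prod>s<n. K (w s) (w (Suc s))) = \<P>(\<omega> in L. \<forall>s\<le>n. \<omega> s = w s)"
      unfolding L by (rule cyl[symmetric]) (use w in auto)
    finally show "\<P>(\<omega> in L. \<omega> (Suc n) = y \<bar> \<forall>s\<le>n. \<omega> s = w s) = K (w n) y"
      using pos by (simp add: cond_prob_def)
  qed
  then show ?thesis by blast
qed

lemma tau_eq: "tau = Complex (- 1 / 2) (sqrt 3 / 2)"
proof -
  have "tau = cis (2 * pi / 3)" by (simp add: tau_def cis_conv_exp mult_ac)
  then show ?thesis by (simp add: cis.ctr cos_120 sin_120)
qed

lemma tau_square: "tau ^ 2 = - 1 - tau"
  by (simp add: tau_eq power2_eq_square complex_eq_iff)

lemma tri_lattice_step: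
  assumes "v \<in> tri_lattice" "k < 3" shows "v + tau ^ k \<in> tri_lattice"
proof -
  obtain a b where v: "v = of_int a + of_int b * tau" using assms by (auto simp: tri_lattice_def)
  consider "k = 0" | "k = 1" | "k = 2" using assms(2) by linarith
  then show ?thesis
  proof cases
    case 1
    then have "v + tau ^ k = of_int (a + 1) + of_int b * tau" by (simp add: v)
    then show ?thesis unfolding tri_lattice_def by blast
  next
    case 2
    then have "v + tau ^ k = of_int a + of_int (b + 1) * tau" by (simp add: v algebra_simps)
    then show ?thesis unfolding tri_lattice_def by blast
  next
    case 3
    then have "v + tau ^ k = of_int (a - 1) + of_int (b - 1) * tau"
      by (simp add: v tau_square algebra_simps)
    then show ?thesis unfolding tri_lattice_def by blast
  qed
qed

lemma countable_tri_lattice: "countable tri_lattice"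
proof -
  have "tri_lattice = (\<lambda>(a, b). of_int a + of_int b * tau) ` (UNIV :: (int \<times> int) set)"
    by (auto simp: tri_lattice_def)
  then show ?thesis by (metis countableI_type countable_image)
qed

lemma lattice_law_exists:
  assumes x: "x \<in> tri_lattice"
    and p: "\<And>v k. p v k \<ge> 0" "\<And>v. (\<Sum>k<3. p v k) = 1"
  shows "\<exists>L. markov_law tri_lattice (lattice_kernel p) x L"
proof (rule markov_law_exists[OF countable_tri_lattice x])
  fix v assume v: "v \<in> tri_lattice"
  define f where "f = (\<lambda>k. if k < 3 then p v k else 0)"
  have "(\<integral>\<^sup>+k. ennreal (f k) \<partial>count_space UNIV) = (\<Sum>k<3. ennreal (f k))"
    by (rule nn_integral_count_space'[where A = "{..<3}", simplified]) (auto simp: f_def)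
  also have "\<dots> = ennreal (\<Sum>k<3. p v k)" using p by (subst sum_ennreal) (auto simp: f_def)
  finally have f1: "(\<integral>\<^sup>+k. ennreal (f k) \<partial>count_space UNIV) = 1" using p by simp
  define r where "r = embed_pmf f"
  have r: "pmf r k = f k" for k
    unfolding r_def by (rule pmf_embed_pmf) (use p f1 in \<open>auto simp: f_def\<close>)
  have sr: "set_pmf r \<subseteq> {..<3}" by (auto simp: set_pmf_iff r f_def split: if_splits)
  show "\<exists>q. set_pmf q \<subseteq> tri_lattice \<and> (\<forall>w\<in>tri_lattice. pmf q w = lattice_kernel p v w)"
  proof (intro exI[of _ "map_pmf (\<lambda>k. v + tau ^ k) r"] conjI ballI)
    show "set_pmf (map_pmf (\<lambda>k. v + tau ^ k) r) \<subseteq> tri_lattice"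
      using tri_lattice_step[OF v] sr by auto
    fix w
    have "pmf (map_pmf (\<lambda>k. v + tau ^ k) r) w = measure r ({k. w = v + tau ^ k} \<inter> set_pmf r)"
      by (auto simp: pmf_map vimage_def measure_Int_set_pmf intro!: arg_cong[where f = "measure r"])
    also have "\<dots> = measure r ({k. k < 3 \<and> w = v + tau ^ k} \<inter> set_pmf r)"
      using sr by (intro arg_cong[where f = "measure r"]) auto
    also have "\<dots> = lattice_kernel p v w"
      unfolding measure_Int_set_pmf lattice_kernel_def
      by (subst measure_measure_pmf_finite) (auto simp: r f_def intro!: sum.cong)
    finally show "pmf (map_pmf (\<lambda>k. v + tau ^ k) r) w = lattice_kernel p v w" .
  qed
qed

lemma tilted_law_exists:
  assumes "x \<in> tri_lattice" shows "\<exists>Q. markov_law tri_lattice (tilted_kernel \<alpha>) x Q"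
proof -
  have pos: "total_weight \<alpha> v > 0" for v
    unfolding total_weight_def by (intro sum_pos) (auto simp: lessThan_empty_iff)
  show ?thesis unfolding tilted_kernel_def
  proof (rule lattice_law_exists[OF assms])
    show "exp (\<alpha> v k) / total_weight \<alpha> v \<ge> 0" for v k using pos[of v] by simp
    show "(\<Sum>k<3. exp (\<alpha> v k) / total_weight \<alpha> v) = 1" for v
      using pos[of v] by (simp add: sum_divide_distrib[symmetric] total_weight_def)
  qed
qed

lemma srw_law_exists:
  assumes "x \<in> tri_lattice" shows "\<exists>P. markov_law tri_lattice srw_kernel x P"
  unfolding srw_kernel_def by (rule lattice_law_exists[OF assms]) auto

end

theory Submission
  imports Defs
begin

text \<open>Both path probabilities are products of transition probabilities, so the quotient factorizes
  over the steps.  Since \<open>\<langle>tau ^ j, tau ^ k\<rangle>\<close> is \<open>1\<close> for \<open>j = k\<close> and \<open>- 1 / 2\<close> otherwise, the drift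
  pairs with \<open>tau ^ k\<close> to \<open>\<alpha> v k\<close> minus the mean of the three weights; as the logarithm of the
  definition of \<open>beta\<close> gives \<open>beta\<^sup>2 / 3\<close> as \<open>ln (a / 3)\<close> minus the same mean, the mean cancels.\<close>

text \<open>Chain rule by induction on \<open>n\<close>: each further coordinate contributes one
  conditional probability, which \<open>markov_law\<close> identifies with an entry of
  \<open>K\<close>.\<close>

lemma markov_law_path_prob:
  assumes L: "markov_law S K x L" and "w 0 = x" and S: "\<And>s. s \<le> n \<Longrightarrow> w s \<in> S"
  shows "\<P>(\<omega> in L. \<forall>s\<le>n. \<omega> s = w s) = (\<Prod>s<n. K (w s) (w (Suc s)))"
  using S
proof (induction n)
  case 0
  then show ?case using L \<open>w 0 = x\<close> by (simp add: markov_law_def)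
next
  case (Suc n)
  interpret prob_space L using L by (simp add: markov_law_def)
  have sets_L: "sets L = sets (PiM UNIV (\<lambda>_. count_space S))"
    using L by (simp add: markov_law_def)
  define A where "A = {\<omega> \<in> space L. \<forall>s\<le>n. \<omega> s = w s}"
  define B where "B = {\<omega> \<in> space L. \<forall>s\<le>Suc n. \<omega> s = w s}"
  have IH: "prob A = (\<Prod>s<n. K (w s) (w (Suc s)))"
    unfolding A_def using Suc by simp
  \<comment> \<open>The event is brought to the form of the numerator in
    \<open>cond_prob\<close>.\<close>
  have B_eq: "B = {\<omega> \<in> space L. \<omega> (Suc n) = w (Suc n) \<and> (\<forall>s\<le>n. \<omega> s = w s)}"
    by (auto simp: B_def le_Suc_eq)
  have coord: "{\<omega> \<in> space L. \<omega> s = w s} \<in> sets L" if "s \<le> n" for s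
  proof -
    have "(\<lambda>\<omega>. \<omega> s) \<in> L \<rightarrow>\<^sub>M count_space S"
      unfolding measurable_cong_sets[OF sets_L refl] by (rule measurable_component_singleton) simp
    moreover have "{w s} \<in> sets (count_space S)" using Suc.prems that by simp
    ultimately have "(\<lambda>\<omega>. \<omega> s) -` {w s} \<inter> space L \<in> sets L" by (rule measurable_sets)
    then show ?thesis by (simp add: vimage_def Int_def conj_commute)
  qed
  have A: "A \<in> sets L"
    using sets.sets_Collect_finite_All[of "{..n}" L "\<lambda>s \<omega>. \<omega> s = w s"] coord by (auto simp: A_def)
  have "prob B = prob A * K (w n) (w (Suc n))"
  \<comment> \<open>\<open>markov_law\<close> prescribes conditional probabilities only after
    histories of positive probability; after a null history both sides vanish because
    \<open>B\<close> is contained in \<open>A\<close>.\<close>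
  proof (cases "prob A = 0")
    case True
    have "prob B \<le> prob A" by (rule finite_measure_mono[OF _ A]) (auto simp: A_def B_def)
    with True show ?thesis by (simp add: measure_le_0_iff)
  next
    case False
    then have pos: "prob A > 0" by (simp add: zero_less_measure_iff)
    then have "\<P>(\<omega> in L. \<omega> (Suc n) = w (Suc n) \<bar> \<forall>s\<le>n. \<omega> s = w s) = K (w n) (w (Suc n))"
      using L Suc.prems[of "Suc n"] by (auto simp: markov_law_def A_def)
    with pos show ?thesis
      by (simp add: cond_prob_def B_eq flip: A_def) (simp add: field_simps)
  qed
  with IH show ?case by (simp add: B_def)
qed

text \<open>Distinctness of the three steps is what reduces the sum in \<open>lattice_kernel\<close>
  to a single term.\<close>

lemma inj_on_tau_power: "inj_on (\<lambda>k. tau ^ k) {..<3}"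
  unfolding inj_on_def
  by (auto simp: numeral_3_eq_3 less_Suc_eq tau_square[unfolded numeral_2_eq_2, simplified]
      tau_eq complex_eq_iff)

lemma lattice_kernel_step:
  assumes "k < 3" shows "lattice_kernel p v (v + tau ^ k) = p v k"
proof -
  have "{j. j < 3 \<and> v + tau ^ k = v + tau ^ j} = {k}"
    using inj_on_tau_power assms by (auto simp: inj_on_def)
  then show ?thesis by (simp add: lattice_kernel_def)
qed

lemma sum_lessThan_3: "(\<Sum>k<3. f k) = f 0 + f 1 + f (2::nat)"
  for f :: "nat \<Rightarrow> 'a::comm_monoid_add"
  by (simp add: numeral_3_eq_3 numeral_2_eq_2)

lemma total_weight_pos: "total_weight \<alpha> v > 0"
  unfolding total_weight_def by (intro sum_pos) (auto simp: lessThan_empty_iff)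

text \<open>Pairing the weighted sum of the \<open>tau ^ j\<close> with \<open>tau ^ k\<close> gives
  3/2 times \<open>\<alpha> v k\<close> minus half the sum of all three weights; the factor 2/3 in
  \<open>drift\<close> normalizes the first coefficient to 1.\<close>

lemma drift_inner_step:
  assumes "k < 3" shows "drift \<alpha> v \<bullet> tau ^ k = \<alpha> v k - (\<Sum>j<3. \<alpha> v j) / 3"
proof -
  have [simp]: "Re tau = - 1 / 2" "Im tau = sqrt 3 / 2" "Re (tau\<^sup>2) = - 1 / 2" "Im (tau\<^sup>2) = - sqrt 3 / 2"
    by (simp_all only: tau_square) (simp_all add: tau_eq)
  have [simp]: "sqrt 3 * (sqrt 3 * y) = 3 * y" for y
    by (simp flip: mult.assoc)
  consider "k = 0" | "k = 1" | "k = 2" using assms by linarith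
  then show ?thesis
    by cases (simp_all add: drift_def sum_lessThan_3 inner_complex_def field_simps)
qed

text \<open>By concavity of the logarithm the right-hand side is nonnegative, so that the description
  defining \<open>beta\<close> is satisfied by its square root.\<close>

lemma beta_square: "(beta \<alpha> v)\<^sup>2 = 3 * ln (total_weight \<alpha> v / 3) - (\<Sum>k<3. \<alpha> v k)"
proof -
  define a where "a = total_weight \<alpha> v"
  define c where "c = 3 * ln (a / 3) - (\<Sum>k<3. \<alpha> v k)"
  have a: "a > 0" unfolding a_def by (rule total_weight_pos)
  \<comment> \<open>Jensen's inequality for \<open>exp\<close> with equal weights, which is the
    inequality of arithmetic and geometric means for the \<open>exp (\<alpha> v k)\<close>.\<close>
  have "exp ((\<Sum>k<3. (1/3) *\<^sub>R \<alpha> v k)) \<le> (\<Sum>k<3. (1/3) * exp (\<alpha> v k))"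
    by (rule convex_on_sum[OF _ _ exp_convex]) (auto simp: lessThan_empty_iff)
  then have "exp ((\<Sum>k<3. \<alpha> v k) / 3) \<le> a / 3"
    by (simp add: a_def total_weight_def sum_lessThan_3 add_divide_distrib)
  then have "(\<Sum>k<3. \<alpha> v k) / 3 \<le> ln (a / 3)"
    using a by (subst ln_ge_iff) simp_all
  then have c: "c \<ge> 0" by (simp add: c_def)
  have "(a / 3) powi (-3) = exp (- 3 * ln (a / 3))"
    using a by (simp add: power_int_minus exp_minus exp_of_nat_mult[of 3, simplified])
  then have eq: "(a / 3) powi (-3) * (\<Prod>k<3. exp (\<alpha> v k)) = exp (- c)"
    by (simp add: c_def exp_sum exp_diff exp_minus field_simps)
  have "beta \<alpha> v = sqrt c"
    unfolding beta_def
  proof (rule the_equality)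
    show "sqrt c \<ge> 0 \<and> exp (- ((sqrt c)\<^sup>2)) =
        (total_weight \<alpha> v / 3) powi (-3) * (\<Prod>k<3. exp (\<alpha> v k))"
      using c eq by (simp add: a_def)
  next
    fix b assume "b \<ge> 0 \<and> exp (- (b\<^sup>2)) =
        (total_weight \<alpha> v / 3) powi (-3) * (\<Prod>k<3. exp (\<alpha> v k))"
    \<comment> \<open>Injectivity of \<open>exp\<close> determines the square, and the sign
      condition then selects the root.\<close>
    then have "b \<ge> 0" "b\<^sup>2 = c" using eq by (simp_all add: a_def)
    then show "b = sqrt c" by (metis real_sqrt_unique)
  qed
  then show ?thesis using c by (simp add: c_def a_def)
qed

text \<open>Once the mean cancels, the exponent is the logarithm of
  \<open>exp (\<alpha> v k) / total_weight \<alpha> v\<close> over 1/3. The term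
  \<open>beta\<^sup>2 / 3\<close> is the share of one step in half of \<open>V_term\<close>.\<close>

lemma kernel_ratio_step:
  assumes "k < 3"
  shows "tilted_kernel \<alpha> v (v + tau ^ k) / srw_kernel v (v + tau ^ k) =
    exp (drift \<alpha> v \<bullet> tau ^ k - (beta \<alpha> v)\<^sup>2 / 3)"
proof -
  have "drift \<alpha> v \<bullet> tau ^ k - (beta \<alpha> v)\<^sup>2 / 3 = \<alpha> v k - ln (total_weight \<alpha> v / 3)"
    by (simp add: drift_inner_step[OF assms] beta_square diff_divide_distrib)
  then show ?thesis
    using total_weight_pos[of \<alpha> v]
    by (simp add: tilted_kernel_def srw_kernel_def lattice_kernel_step[OF assms] exp_diff)
qed

theorem theorem1p3:
  fixes \<alpha> :: "complex \<Rightarrow> nat \<Rightarrow> real"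
    and x :: complex
    and Q P :: "(nat \<Rightarrow> complex) measure"
    and \<gamma> :: "nat \<Rightarrow> complex"
    and n :: nat
  assumes "markov_law tri_lattice (tilted_kernel \<alpha>) x Q"
    and "markov_law tri_lattice srw_kernel x P"
    and "\<And>s. s \<le> n \<Longrightarrow> \<gamma> s \<in> tri_lattice"
    and "\<gamma> 0 = x"
    and "\<And>s. s < n \<Longrightarrow> \<gamma> (s + 1) - \<gamma> s \<in> {1, tau, tau ^ 2}"
  shows "\<P>(\<omega> in Q. \<forall>s\<le>n. \<omega> s = \<gamma> s) / \<P>(\<omega> in P. \<forall>s\<le>n. \<omega> s = \<gamma> s)
           = exp (M_term \<alpha> \<gamma> n - 1 / 2 * V_term \<alpha> \<gamma> n)"
proof -
  have step: "tilted_kernel \<alpha> (\<gamma> s) (\<gamma> (Suc s)) / srw_kernel (\<gamma> s) (\<gamma> (Suc s)) =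
      exp (drift \<alpha> (\<gamma> s) \<bullet> (\<gamma> (s + 1) - \<gamma> s) - (beta \<alpha> (\<gamma> s))\<^sup>2 / 3)" if "s < n" for s
  proof -
    obtain k where k: "k < 3" "\<gamma> (s + 1) - \<gamma> s = tau ^ k"
    proof -
      have "\<gamma> (s + 1) - \<gamma> s = tau ^ 0 \<or> \<gamma> (s + 1) - \<gamma> s = tau ^ 1 \<or> \<gamma> (s + 1) - \<gamma> s = tau ^ 2"
        using assms(5)[OF \<open>s < n\<close>] by simp
      then show thesis
        using that[of 0] that[of 1] that[of 2] by (elim disjE) simp_all
    qed
    then have "\<gamma> (Suc s) = \<gamma> s + tau ^ k" by (simp add: algebra_simps)
    with k kernel_ratio_step[OF k(1)] show ?thesis by simp
  qed
  have "\<P>(\<omega> in Q. \<forall>s\<le>n. \<omega> s = \<gamma> s) / \<P>(\<omega> in P. \<forall>s\<le>n. \<omega> s = \<gamma> s) =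
      (\<Prod>s<n. tilted_kernel \<alpha> (\<gamma> s) (\<gamma> (Suc s)) / srw_kernel (\<gamma> s) (\<gamma> (Suc s)))"
    using assms(1-4) by (simp add: markov_law_path_prob prod_dividef)
  also have "\<dots> = exp (\<Sum>s<n. drift \<alpha> (\<gamma> s) \<bullet> (\<gamma> (s + 1) - \<gamma> s) - (beta \<alpha> (\<gamma> s))\<^sup>2 / 3)"
    by (simp add: exp_sum step)
  also have "\<dots> = exp (M_term \<alpha> \<gamma> n - 1 / 2 * V_term \<alpha> \<gamma> n)"
    by (simp add: M_term_def V_term_def sum_subtractf sum_divide_distrib)
  finally show ?thesis .
qed

end
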